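(* Let $N$ be an odd positive integer, $W$ a compact closed oriented 3-manifold, $L\subset W$ a link, and $\rho$ an equivalence class of flat principal $B$-bundles on $W$, where $B$ is the group of upper triangular matrices in $SL(2,\mathbb{C})$. Let $\mathcal{T}=(T,H,(b,z,c))$ be any decorated distinguished triangulation of $(W,L)$ with $[z]=\rho$, and write $z(e)=\begin{pmatrix} t(e)&x(e)\\0&t(e)^{-1}\end{pmatrix}$. For $\lambda\in\mathbb{C}^*$ let $z_\lambda$ be the full cocycle with $t_\lambda(e)=t(e)$ and $x_\lambda(e)=\lambda x(e)$ for every edge $e$, and let $\rho_\lambda=[z_\lambda]$. Then for each $\lambda\neq0$, $$K_N(W,L,\rho_\lambda)=K_N(W,L,\rho).$$
   Context: **Triangulations.** $W$ is connected. A *triangulation* $T$ of $W$ means a singular triangulation: self-adjacencies and multiple adjacencies of simplices are allowed. $E(T)$, $F(T)$ are the sets of edges and 2-faces of $T$, $r_0$ is the number of vertices of $T$. "Abstract" tetrahedra are the tetrahedra before gluing; $E_\Delta(T)$ is the set of all edges of all abstract tetrahedra, and $\epsilon:E_\Delta(T)\to E(T)$ is the natural identification map. A *distinguished triangulation* $(T,H)$ of $(W,L)$ is a triangulation $T$ of $W$ with a subcomplex $H$ of its 1-skeleton which realizes $L$ and is Hamiltonian: at each vertex of $T$ there are exactly two germs of edges of $H$. **Branching $b$.** A system of orientations of the edges of $T$ such that the edge orientations do not induce an orientation of the boundary of any 2-face; equivalently each abstract tetrahedron $\Delta$ has one source and one sink on its 1-skeleton. It orders the vertices of each $\Delta$ as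 $v_0,v_1,v_2,v_3$ ($v_i$ has exactly $i$ incoming edges in $\Delta$; edges go from smaller to bigger index). The ordered triple of edges $v_0v_1,v_0v_2,v_0v_3$ orients $\Delta$; the *index* of $\Delta$ is $-1$ if this orientation agrees with that of $W$, and $+1$ otherwise. **Full cocycle $z$.** A $B$-valued cellular 1-cocycle on $T$: a matrix $z(e)=\begin{pmatrix} t(e)&x(e)\\0&t(e)^{-1}\end{pmatrix}$ for each $b$-oriented edge $e$, with $z(v_0v_1)z(v_1v_2)=z(v_0v_2)$ on each 2-face with $b$-ordered vertices $v_0,v_1,v_2$ (reversing an edge inverts the matrix). *Full* means $x(e)\ne 0$ for every edge $e$. Cocycles $z,z'$ are equivalent if $z'(e)=\lambda(v_0)^{-1}z(e)\lambda(v_1)$ for some function $\lambda$ from vertices to $B$ ($e$ going from $v_0$ to $v_1$); the set of classes $[z]$ is identified with the set of equivalence classes of flat principal $B$-bundles on $W$. **Charge $c$.** Let $U(L)$ be a tubular neighbourhood of $L$ and $M=W\setminus \mathrm{Int}\,U(L)$. Let $P$ be the 2-skeleton of the cell decomposition dual to $T$, and $\widetilde P$ the polyhedron obtained from $P$ by removing the open regions dual to the edges of $H$; it is a spine of $M$, assumed to be standard (i.e. a simple polyhedron all of whose strata are open cells). Its dual is an ideal triangulation $T(\widetilde P)$ of $M$; truncating its tetrahedra at the vertices induces a triangulation $\tau$ of $\partial M$. The tetrahedra of $T(\widetilde P)$ correspond to the vertices of $\widetilde P$, which are vertices of $P$, hence to certain abstract tetrahedra of $T$; in this way a function on $E_\Delta(T)$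 assigns integers to the edges of abstract tetrahedra of $T(\widetilde P)$, hence to the vertices of the (abstract) triangles of $\tau$. A curve on $\partial M$ in general position with respect to $\tau$ (resp. in $M$ in general position with respect to $T(\widetilde P)$) has no back-tracking if it never leaves a triangle (resp. tetrahedron) through the edge (resp. face) by which it entered; each time it crosses a triangle (resp. tetrahedron) it selects the vertex (resp. edge) between the entering and departing sides. On $\partial M$ a selected vertex gets the sign $\pm1$ according to whether the oriented curve goes past it positively or negatively with respect to the boundary orientation. On each component of $\partial M$ fix oriented simple closed curves $m_i$ (a meridian of $L_i$) and $l_i$ meeting transversely at one point, without back-tracking. An *integral charge* is a map $c':E_\Delta(T)\to\mathbb{Z}$ such that: (1) for each 2-face of each abstract tetrahedron the sum of $c'$ over its three edges is $1$; $\sum_{e'\in\epsilon^{-1}(e)}c'(e')=2$ for $e\in E(T)\setminus E(H)$ and $=0$ for $e\in E(H)$; (2) for each $s\in\{m_i,l_i\}$ the sum of the signed integers assigned by $c'$ to the vertices selected by $s$ is $0$; (3) for every curve $s$ in $M$ without back-tracking with respect to $T(\widetilde P)$ the sum of the integers assigned by $c'$ to the edges selected by $s$ is even. A *charge* is $c:E_\Delta(T)\to\mathbb{Z}/N\mathbb{Z}$ of the form $c\equiv (p+1)c' \bmod N$ with $c'$ an integral charge, where $N=2p+1$ (so $p+1=1/2$ in $\mathbb{Z}/N\mathbb{Z}$). A *decorated distinguished triangulation* is $\mathcal{T}=(T,H,\mathcal{D}=(b,z,c))$ with $(T,H)$ distinguished, $b$ a branching, $z$ a full cocycle, $c$ a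 charge. A *determination* $d$ of the $N$-th root holding for $z$ is a branch of $w\mapsto w^{1/N}$ on a domain of $\mathbb{C}^*$ containing all the nonzero entries of all the matrices $z(e)$; all $N$-th roots $x(e)^{1/N}$ below are taken with $d$. **Quantum data.** $N=2p+1$, $\omega=\exp(2i\pi/N)$, exponents of $\omega$ are in $\mathbb{Z}/N\mathbb{Z}$ with $1/2:=p+1$; $\delta(n)=1$ if $n\equiv0\bmod N$ and $0$ otherwise. For $x^N+y^N=z^N$, $y\neq0$, put $\Omega(x,y,z\mid n)=\prod_{j=1}^{n}\frac{y}{z-x\omega^j}$, which is $N$-periodic in $n$, and $\Omega(x,y,z\mid m,n)=\Omega(x,y,z\mid m-n)\,\omega^{n^2/2}$. Put $g(x)=\prod_{j=1}^{N-1}(1-x\omega^j)^{j/N}$ (branch with $g(0)=1$; only $N$-th powers of products of values of $g$ enter the final formula), $h(x)=x^{-p}g(x)/g(1)$, $[x]=N^{-1}\frac{1-x^N}{1-x}$. A *state* is a map $\alpha:F(T)\to\mathbb{Z}/N\mathbb{Z}$. For a tetrahedron $\Delta$ with $b$-ordered vertices $v_0,\dots,v_3$ let $x_{ij}=x(v_iv_j)^{1/N}$, $c_{ij}=c(v_iv_j)$, and $\alpha_k$ the value of $\alpha$ on the face opposite to $v_k$. Set $A=(x_{03}x_{12},\,x_{01}x_{23},\,x_{02}x_{13})$, $A'=(x_{03}x_{12}/\omega,\,x_{01}x_{23},\,x_{02}x_{13})$ and $\nu=h\!\left(\frac{x_{02}x_{13}}{x_{03}x_{12}}\right)$. If $\Delta$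 has index $-1$, $$t^\Delta(\mathcal{D},\alpha,d)=(x_{02}x_{13})^p\,\omega^{c_{12}(\alpha_2-\alpha_3)-c_{01}c_{12}/2}\;\nu\;\omega^{\alpha_3\alpha_0}\,\Omega(A\mid\alpha_2-c_{01},\alpha_3)\,\delta(\alpha_2+\alpha_0-\alpha_1),$$ and if $\Delta$ has index $+1$, $$t^\Delta(\mathcal{D},\alpha,d)=(x_{02}x_{13})^p\,\omega^{c_{12}(\alpha_2-\alpha_3)+c_{01}c_{12}/2}\;\frac{\left[\frac{x_{03}x_{12}}{x_{02}x_{13}}\right]}{\nu}\;\omega^{-\alpha_3\alpha_0}\,\frac{\delta(\alpha_2+\alpha_0-\alpha_1)}{\Omega(A'\mid\alpha_2+c_{01},\alpha_3)}.$$ The state sum is $$K_N(\mathcal{T},d)=\Big(N^{-r_0}\sum_{\alpha}\prod_{\Delta}t^{\Delta}(\mathcal{D},\alpha,d)\prod_{e\in E(T)\setminus E(H)}x(e)^{-2p/N}\Big)^N ,$$ and $K_N(W,L,\rho)$ denotes the common value of $K_N(\mathcal{T},d)$ over all decorated distinguished triangulations $\mathcal{T}$ of $(W,L)$ with $[z]=\rho$ and all determinations $d$ (such $\mathcal{T}$ exist and the value is independent of the choices). *)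

theory Defs
  imports "HOL-Analysis.Analysis" "HOL-Homology.Homology"
begin

section \<open>Oriented closed 3-manifolds and links\<close>

definition closed_3manifold :: "'w topology \<Rightarrow> bool" where
  "closed_3manifold W \<longleftrightarrow> topspace W \<noteq> {} \<and> Hausdorff_space W \<and> compact_space W \<and>
     (\<forall>x\<in>topspace W. \<exists>U. openin W U \<and> x \<in> U \<and>
        subtopology W U homeomorphic_space (euclidean :: (real^3) topology))"

text \<open>An orientation is a locally coherent choice, for each point \<open>x\<close>, of a generator of the local
  homology group \<open>H\<^sub>3(W, W - x)\<close>.\<close>

definition is_orientation :: "'w topology \<Rightarrow> ('w \<Rightarrow> 'w chain set) \<Rightarrow> bool" where
  "is_orientation W ori \<longleftrightarrow> (\<forall>x\<in>topspace W.
     (let G = relative_homology_group 3 W (topspace W - {x})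
      in ori x \<in> carrier G \<and> generate G {ori x} = carrier G) \<and>
     (\<exists>U. openin W U \<and> x \<in> U \<and>
        (\<exists>a \<in> carrier (relative_homology_group 3 W (topspace W - U)).
           \<forall>y\<in>U. hom_induced 3 W (topspace W - U) W (topspace W - {y}) id a = ori y)))"

text \<open>A link is a closed, locally flat 1-submanifold without boundary; by compactness it is a finite
  disjoint union of tame circles.\<close>

definition is_link :: "'w topology \<Rightarrow> 'w set \<Rightarrow> bool" where
  "is_link W L \<longleftrightarrow> closedin W L \<and>
     (\<forall>x\<in>L. \<exists>U f. openin W U \<and> x \<in> U \<and>
        homeomorphic_map (subtopology W U) (euclidean :: (real^3) topology) f \<and>
        f ` (U \<inter> L) = {v. v$2 = 0 \<and> v$3 = 0})"

section \<open>Singular triangulations\<close>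

text \<open>
  The abstract tetrahedra are numbered \<open>0, \<dots>, ntet - 1\<close>, and each has vertices \<open>0, 1, 2, 3\<close>.
  Face \<open>m\<close> of a tetrahedron is the one opposite to its vertex \<open>m\<close>. If \<open>glue i m = (j, \<pi>)\<close>, then
  face \<open>m\<close> of tetrahedron \<open>i\<close> is glued to face \<open>\<pi> m\<close> of tetrahedron \<open>j\<close> by the affine map sending
  vertex \<open>l \<noteq> m\<close> to vertex \<open>\<pi> l\<close>. The map \<open>chmap i\<close> sends tetrahedron \<open>i\<close> (the standard
  3-simplex, in barycentric coordinates) to the manifold.
\<close>

record 'w triangulation =
  ntet :: nat
  glue :: "nat \<Rightarrow> nat \<Rightarrow> nat \<times> (nat \<Rightarrow> nat)"
  chmap :: "nat \<Rightarrow> (nat \<Rightarrow> real) \<Rightarrow> 'w"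

definition gluing_ok :: "('w, 'm) triangulation_scheme \<Rightarrow> bool" where
  "gluing_ok T \<longleftrightarrow> (\<forall>i<ntet T. \<forall>m<4. case glue T i m of (j, \<pi>) \<Rightarrow>
     j < ntet T \<and> \<pi> permutes {..<4} \<and> glue T j (\<pi> m) = (i, inv_into UNIV \<pi>) \<and> (j, \<pi> m) \<noteq> (i, m))"

definition point_rel :: "('w, 'm) triangulation_scheme \<Rightarrow> ((nat \<times> (nat \<Rightarrow> real)) \<times> (nat \<times> (nat \<Rightarrow> real))) set" where
  "point_rel T = {((i, x), (j, x \<circ> inv_into UNIV \<pi>)) | i x j \<pi> m.
     i < ntet T \<and> m < 4 \<and> x \<in> standard_simplex 3 \<and> x m = 0 \<and> glue T i m = (j, \<pi>)}\<^sup>*"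

text \<open>The manifold is the quotient of the disjoint union of the tetrahedra by the gluing; since
  it is compact Hausdorff, the continuous bijection from the quotient is a homeomorphism.\<close>

definition triangulates :: "('w, 'm) triangulation_scheme \<Rightarrow> 'w topology \<Rightarrow> bool" where
  "triangulates T W \<longleftrightarrow> gluing_ok T \<and>
     (\<forall>i<ntet T. singular_simplex 3 W (chmap T i)) \<and>
     (\<Union>i<ntet T. chmap T i ` standard_simplex 3) = topspace W \<and>
     (\<forall>i<ntet T. \<forall>j<ntet T. \<forall>x\<in>standard_simplex 3. \<forall>y\<in>standard_simplex 3.
        chmap T i x = chmap T j y \<longleftrightarrow> ((i, x), (j, y)) \<in> point_rel T)"

text \<open>An abstract simplex is a pair \<open>(i, S)\<close>, with \<open>S\<close> a set of vertices of tetrahedron \<open>i\<close>;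
  the simplices of \<open>T\<close> are the classes of abstract simplices modulo the gluing.\<close>

definition abstract_simplices :: "('w, 'm) triangulation_scheme \<Rightarrow> nat \<Rightarrow> (nat \<times> nat set) set" where
  "abstract_simplices T d = {(i, S). i < ntet T \<and> S \<subseteq> {..<4} \<and> card S = Suc d}"

definition simplex_rel :: "('w, 'm) triangulation_scheme \<Rightarrow> ((nat \<times> nat set) \<times> (nat \<times> nat set)) set" where
  "simplex_rel T = {((i, S), (j, \<pi> ` S)) | i S j \<pi> m.
     i < ntet T \<and> m < 4 \<and> S \<subseteq> {..<4} - {m} \<and> glue T i m = (j, \<pi>)}\<^sup>*"

definition simplices :: "('w, 'm) triangulation_scheme \<Rightarrow> nat \<Rightarrow> (nat \<times> nat set) set set" where
  "simplices T d = abstract_simplices T d // simplex_rel T"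

abbreviation "verts T \<equiv> simplices T 0"
abbreviation "edges T \<equiv> simplices T 1"
abbreviation "faces T \<equiv> simplices T 2"

text \<open>The identification map \<open>\<epsilon>\<close> (on edges), and likewise for the other simplices. The class of
  an abstract simplex is its own fibre, so \<open>\<epsilon>\<^sup>-\<^sup>1(e) = e\<close> below.\<close>

definition proj_simplex :: "('w, 'm) triangulation_scheme \<Rightarrow> nat \<times> nat set \<Rightarrow> (nat \<times> nat set) set" where
  "proj_simplex T s = simplex_rel T `` {s}"

definition bvertex :: "nat \<Rightarrow> nat \<Rightarrow> real" where
  "bvertex k = (\<lambda>l. if l = k then 1 else 0)"

definition edge_path :: "('w, 'm) triangulation_scheme \<Rightarrow> nat \<Rightarrow> nat \<Rightarrow> nat \<Rightarrow> real \<Rightarrow> 'w" where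
  "edge_path T i k l = (\<lambda>t. chmap T i (\<lambda>j. (1 - t) * bvertex k j + t * bvertex l j))"

text \<open>Oriented abstract edges \<open>(i, k, l)\<close> (from \<open>k\<close> to \<open>l\<close>) modulo gluing are the oriented edges of
  \<open>T\<close>; an oriented edge is also the germ of an edge at its initial vertex.\<close>

definition oedge_rel :: "('w, 'm) triangulation_scheme \<Rightarrow> ((nat \<times> nat \<times> nat) \<times> (nat \<times> nat \<times> nat)) set" where
  "oedge_rel T = {((i, k, l), (j, \<pi> k, \<pi> l)) | i k l j \<pi> m.
     i < ntet T \<and> m < 4 \<and> {k, l} \<subseteq> {..<4} - {m} \<and> glue T i m = (j, \<pi>)}\<^sup>*"

definition oedges :: "('w, 'm) triangulation_scheme \<Rightarrow> (nat \<times> nat \<times> nat) set set" where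
  "oedges T = {(i, k, l). i < ntet T \<and> k < 4 \<and> l < 4 \<and> k \<noteq> l} // oedge_rel T"

text \<open>A subcomplex of the 1-skeleton containing all vertices is given by its set of edges.\<close>

definition distinguished :: "'w topology \<Rightarrow> 'w set \<Rightarrow> ('w, 'm) triangulation_scheme \<Rightarrow> (nat \<times> nat set) set set \<Rightarrow> bool" where
  "distinguished W L T H \<longleftrightarrow> triangulates T W \<and> H \<subseteq> edges T \<and>
     (\<Union>e\<in>H. \<Union>(i, S)\<in>e. chmap T i ` {x \<in> standard_simplex 3. \<forall>l. l \<notin> S \<longrightarrow> x l = 0}) = L \<and>
     (\<forall>v\<in>verts T. card {g \<in> oedges T. \<exists>(i, k, l)\<in>g.
        proj_simplex T (i, {k}) = v \<and> proj_simplex T (i, {k, l}) \<in> H} = 2)"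

section \<open>Branchings and cocycles\<close>

text \<open>\<open>b i k l\<close> means that the edge \<open>kl\<close> of tetrahedron \<open>i\<close> goes from \<open>k\<close> to \<open>l\<close>.\<close>

type_synonym branching = "nat \<Rightarrow> nat \<Rightarrow> nat \<Rightarrow> bool"

definition is_branching :: "('w, 'm) triangulation_scheme \<Rightarrow> branching \<Rightarrow> bool" where
  "is_branching T b \<longleftrightarrow> (\<forall>i<ntet T.
     (\<forall>k<4. \<forall>l<4. k \<noteq> l \<longrightarrow> b i k l \<longleftrightarrow> \<not> b i l k) \<and>
     (\<forall>m<4. case glue T i m of (j, \<pi>) \<Rightarrow>
        \<forall>k<4. \<forall>l<4. k \<noteq> l \<and> k \<noteq> m \<and> l \<noteq> m \<longrightarrow> b i k l \<longleftrightarrow> b j (\<pi> k) (\<pi> l)) \<and>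
     (\<forall>k<4. \<forall>l<4. \<forall>m<4. distinct [k, l, m] \<longrightarrow> \<not> (b i k l \<and> b i l m \<and> b i m k)))"

definition branch_vertex :: "branching \<Rightarrow> nat \<Rightarrow> nat \<Rightarrow> nat" where
  "branch_vertex b i r = (THE k. k < 4 \<and> card {l. l < 4 \<and> l \<noteq> k \<and> b i l k} = r)"

text \<open>The ordering \<open>vs\<close> of the vertices of tetrahedron \<open>i\<close> is positive if the corresponding singular
  simplex represents the orientation in the local homology at the barycentre, i.e. if the frame
  \<open>(vs\<^sub>1 - vs\<^sub>0, vs\<^sub>2 - vs\<^sub>0, vs\<^sub>3 - vs\<^sub>0)\<close> is positive.\<close>

definition positive_order :: "'w topology \<Rightarrow> ('w \<Rightarrow> 'w chain set) \<Rightarrow> ('w, 'm) triangulation_scheme \<Rightarrow> nat \<Rightarrow> nat list \<Rightarrow> bool" where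
  "positive_order W ori T i vs \<longleftrightarrow>
     (let y = chmap T i (\<lambda>l. if l < 4 then 1/4 else 0)
      in homologous_rel_set 3 W (topspace W - {y})
           (frag_of (simplex_map 3 (chmap T i) (oriented_simplex 3 (\<lambda>r. bvertex (vs ! r))))) = ori y)"

definition tet_index :: "'w topology \<Rightarrow> ('w \<Rightarrow> 'w chain set) \<Rightarrow> ('w, 'm) triangulation_scheme \<Rightarrow> branching \<Rightarrow> nat \<Rightarrow> int" where
  "tet_index W ori T b i =
     (if positive_order W ori T i (map (branch_vertex b i) [0, 1, 2, 3]) then -1 else 1)"

definition borel_group :: "(complex^2^2) set" where
  "borel_group = {A. A$2$1 = 0 \<and> det A = 1}"

text \<open>The value \<open>z e\<close> refers to the edge \<open>e\<close> with its orientation by the branching.\<close>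

type_synonym cocycle = "(nat \<times> nat set) set \<Rightarrow> complex^2^2"

definition is_cocycle :: "('w, 'm) triangulation_scheme \<Rightarrow> branching \<Rightarrow> cocycle \<Rightarrow> bool" where
  "is_cocycle T b z \<longleftrightarrow> (\<forall>e\<in>edges T. z e \<in> borel_group) \<and>
     (\<forall>i<ntet T. \<forall>k<4. \<forall>l<4. \<forall>m<4. distinct [k, l, m] \<and> b i k l \<and> b i l m \<and> b i k m \<longrightarrow>
        z (proj_simplex T (i, {k, l})) ** z (proj_simplex T (i, {l, m})) = z (proj_simplex T (i, {k, m})))"

definition is_full_cocycle :: "('w, 'm) triangulation_scheme \<Rightarrow> branching \<Rightarrow> cocycle \<Rightarrow> bool" where
  "is_full_cocycle T b z \<longleftrightarrow> is_cocycle T b z \<and> (\<forall>e\<in>edges T. z e $ 1 $ 2 \<noteq> 0)"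

definition scale_cocycle :: "complex \<Rightarrow> cocycle \<Rightarrow> cocycle" where
  "scale_cocycle lam z = (\<lambda>e. vector [vector [z e $ 1 $ 1, lam * z e $ 1 $ 2], vector [0, inverse (z e $ 1 $ 1)]])"

section \<open>Flat principal bundles\<close>

text \<open>The flat structure of a principal \<open>B\<close>-bundle (\<open>B\<close> acting on the right) is given by its flat
  local sections: they exist locally, trivialize the bundle, and differ by locally constant
  elements of \<open>B\<close>.\<close>

record ('w, 'e) flat_bundle =
  total :: "'e topology"
  bproj :: "'e \<Rightarrow> 'w"
  bact :: "'e \<Rightarrow> complex^2^2 \<Rightarrow> 'e"
  flat_sections :: "('w set \<times> ('w \<Rightarrow> 'e)) set"

definition is_flat_bundle :: "'w topology \<Rightarrow> ('w, 'e) flat_bundle \<Rightarrow> bool" where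
  "is_flat_bundle W E \<longleftrightarrow>
     continuous_map (total E) W (bproj E) \<and>
     (\<forall>u\<in>topspace (total E). bact E u (mat 1) = u \<and>
        (\<forall>g\<in>borel_group. bact E u g \<in> topspace (total E) \<and> bproj E (bact E u g) = bproj E u \<and>
           (\<forall>h\<in>borel_group. bact E u (g ** h) = bact E (bact E u g) h))) \<and>
     (\<forall>(U, s)\<in>flat_sections E. openin W U \<and>
        (\<forall>x\<in>U. s x \<in> topspace (total E) \<and> bproj E (s x) = x) \<and>
        homeomorphic_map (prod_topology (subtopology W U) (top_of_set borel_group))
          (subtopology (total E) {u \<in> topspace (total E). bproj E u \<in> U})
          (\<lambda>(x, g). bact E (s x) g)) \<and>
     (\<forall>x\<in>topspace W. \<exists>(U, s)\<in>flat_sections E. x \<in> U) \<and>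
     (\<forall>(U, s)\<in>flat_sections E. \<forall>(U', s')\<in>flat_sections E. \<forall>x\<in>U \<inter> U'.
        \<exists>V g. openin W V \<and> x \<in> V \<and> V \<subseteq> U \<inter> U' \<and> g \<in> borel_group \<and>
          (\<forall>y\<in>V. s' y = bact E (s y) g))"

definition flat_bundle_iso :: "'w topology \<Rightarrow> (('w, 'e) flat_bundle \<times> ('w, 'e) flat_bundle) set" where
  "flat_bundle_iso W = {(E, E'). is_flat_bundle W E \<and> is_flat_bundle W E' \<and>
     (\<exists>\<phi>. homeomorphic_map (total E) (total E') \<phi> \<and>
       (\<forall>u\<in>topspace (total E). bproj E' (\<phi> u) = bproj E u \<and>
          (\<forall>g\<in>borel_group. \<phi> (bact E u g) = bact E' (\<phi> u) g)) \<and>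
       (\<forall>(U, s)\<in>flat_sections E. \<forall>(U', s')\<in>flat_sections E'. \<forall>x\<in>U \<inter> U'.
          \<exists>V g. openin W V \<and> x \<in> V \<and> V \<subseteq> U \<inter> U' \<and> g \<in> borel_group \<and>
            (\<forall>y\<in>V. s' y = bact E' (\<phi> (s y)) g)))}"

definition flat_bundle_classes :: "'w topology \<Rightarrow> ('w, 'e) flat_bundle set set" where
  "flat_bundle_classes W = {E. is_flat_bundle W E} // flat_bundle_iso W"

definition horizontal_path :: "('w, 'e) flat_bundle \<Rightarrow> (real \<Rightarrow> 'e) \<Rightarrow> bool" where
  "horizontal_path E \<gamma> \<longleftrightarrow> continuous_map (top_of_set {0..1}) (total E) \<gamma> \<and>
     (\<forall>t\<in>{0..1}. \<exists>(U, s)\<in>flat_sections E. \<exists>g\<in>borel_group. \<exists>r>0. \<forall>t'\<in>{0..1}. \<bar>t' - t\<bar> < r \<longrightarrow>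
        bproj E (\<gamma> t') \<in> U \<and> \<gamma> t' = bact E (s (bproj E (\<gamma> t'))) g)"

text \<open>The class of flat bundles identified with the class of the cocycle \<open>z\<close>: those that have points
  \<open>\<sigma> v\<close> in the fibres over the vertices such that parallel transport along each oriented edge
  from \<open>v\<^sub>0\<close> to \<open>v\<^sub>1\<close> takes \<open>\<sigma>(v\<^sub>0) z(e)\<close> to \<open>\<sigma>(v\<^sub>1)\<close>. Replacing \<open>\<sigma>(v)\<close> by \<open>\<sigma>(v) \<lambda>(v)\<close> replaces
  \<open>z(e)\<close> by \<open>\<lambda>(v\<^sub>0)\<^sup>-\<^sup>1 z(e) \<lambda>(v\<^sub>1)\<close>, so this depends only on the equivalence class of \<open>z\<close>.\<close>

definition cocycle_class :: "'w topology \<Rightarrow> ('w, 'm) triangulation_scheme \<Rightarrow> branching \<Rightarrow> cocycle \<Rightarrow> ('w, 'e) flat_bundle set" where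
  "cocycle_class W T b z = {E. is_flat_bundle W E \<and> (\<exists>\<sigma>.
     (\<forall>i<ntet T. \<forall>k<4. \<sigma> (proj_simplex T (i, {k})) \<in> topspace (total E) \<and>
        bproj E (\<sigma> (proj_simplex T (i, {k}))) = chmap T i (bvertex k)) \<and>
     (\<forall>i<ntet T. \<forall>k<4. \<forall>l<4. k \<noteq> l \<and> b i k l \<longrightarrow>
        (\<exists>\<gamma>. horizontal_path E \<gamma> \<and> (\<forall>t\<in>{0..1}. bproj E (\<gamma> t) = edge_path T i k l t) \<and>
           \<gamma> 0 = bact E (\<sigma> (proj_simplex T (i, {k}))) (z (proj_simplex T (i, {k, l}))) \<and>
           \<gamma> 1 = \<sigma> (proj_simplex T (i, {l})))))}"

section \<open>The spine dual to a distinguished triangulation\<close>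

text \<open>In barycentric coordinates, the dual cell of a simplex meets a tetrahedron in the points whose
  coordinates are maximal at the vertices of that simplex. So the dual 2-skeleton consists of the
  points with at least two maximal coordinates, and its open 2-cells of those with exactly two.\<close>

definition max_coords :: "(nat \<Rightarrow> real) \<Rightarrow> nat set" where
  "max_coords x = {k. k < 4 \<and> (\<forall>l<4. x l \<le> x k)}"

definition dual_spine :: "('w, 'm) triangulation_scheme \<Rightarrow> (nat \<times> nat set) set set \<Rightarrow> 'w set" where
  "dual_spine T H = {chmap T i x | i x. i < ntet T \<and> x \<in> standard_simplex 3 \<and>
     2 \<le> card (max_coords x) \<and> proj_simplex T (i, max_coords x) \<notin> H}"

text \<open>Local models of simple polyhedra. For \<open>n = 3\<close>, the set below is the union of three half-lines
  with common origin; for \<open>n = 4\<close> it is the cone over the complete graph on four vertices.\<close>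

definition cone_model :: "(real^'n) set" where
  "cone_model = {v. (\<Sum>i\<in>UNIV. v$i) = 0 \<and> (\<exists>i j. i \<noteq> j \<and> v$i = v$j \<and> (\<forall>k. v$k \<le> v$i))}"

definition has_local_model :: "'w topology \<Rightarrow> 'w \<Rightarrow> 'v::real_normed_vector set \<Rightarrow> bool" where
  "has_local_model X x S \<longleftrightarrow> (\<exists>U f. openin X U \<and> x \<in> U \<and>
     homeomorphic_map (subtopology X U) (top_of_set S) f \<and> f x = 0)"

definition stratum :: "'w topology \<Rightarrow> nat \<Rightarrow> 'w set" where
  "stratum X d = {x \<in> topspace X.
     if d = 0 then has_local_model X x (cone_model :: (real^4) set)
     else if d = 1 then has_local_model X x ((cone_model :: (real^3) set) \<times> (UNIV :: real set))
     else has_local_model X x (UNIV :: (real^2) set)}"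

definition simple_polyhedron :: "'w topology \<Rightarrow> bool" where
  "simple_polyhedron X \<longleftrightarrow> compact_space X \<and> Hausdorff_space X \<and>
     topspace X = stratum X 0 \<union> stratum X 1 \<union> stratum X 2"

definition standard_polyhedron :: "'w topology \<Rightarrow> bool" where
  "standard_polyhedron X \<longleftrightarrow> simple_polyhedron X \<and>
     (\<forall>C\<in>connected_components_of (subtopology X (stratum X 0)). is_singleton C) \<and>
     (\<forall>C\<in>connected_components_of (subtopology X (stratum X 1)).
        subtopology X C homeomorphic_space (euclidean :: real topology)) \<and>
     (\<forall>C\<in>connected_components_of (subtopology X (stratum X 2)).
        subtopology X C homeomorphic_space (euclidean :: (real^2) topology))"

section \<open>The dual ideal triangulation\<close>

text \<open>
  When the spine is standard, no face has two edges in \<open>H\<close>. The vertices of the spine are the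
  centres of the tetrahedra without edges in \<open>H\<close>, and its triple lines run through the faces
  without edges in \<open>H\<close>.
\<close>

definition ideal_tet :: "('w, 'm) triangulation_scheme \<Rightarrow> (nat \<times> nat set) set set \<Rightarrow> nat \<Rightarrow> bool" where
  "ideal_tet T H i \<longleftrightarrow> i < ntet T \<and>
     (\<forall>k<4. \<forall>l<4. k \<noteq> l \<longrightarrow> proj_simplex T (i, {k, l}) \<notin> H)"

text \<open>
  A triple line leaving tetrahedron \<open>i\<close> through face \<open>m\<close> may run through tetrahedra having one edge
  in \<open>H\<close>. If it enters such a tetrahedron \<open>j\<close> through the face opposite to \<open>a\<close>, the edge in \<open>H\<close>
  is \<open>aa'\<close>; the line leaves through the face opposite to \<open>a'\<close>, and the regions along it match
  the vertices of these two faces by sending \<open>a'\<close> to \<open>a\<close> and fixing the other two. So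
  \<open>ideal_glue T H i m j \<pi> ws\<close> means that the line reaches face \<open>\<pi> m\<close> of tetrahedron \<open>j\<close>, with vertex
  \<open>l\<close> of face \<open>m\<close> going to \<open>\<pi> l\<close>. The list \<open>ws\<close> has the entry \<open>(l, j', a', a)\<close> whenever vertex \<open>l\<close> is
  carried from \<open>a'\<close> to \<open>a\<close> along an edge of \<open>H\<close> in tetrahedron \<open>j'\<close>. If \<open>i\<close> and \<open>j\<close> are both ideal
  tetrahedra, this is a face pairing of the ideal triangulation \<open>T(P~)\<close>.
\<close>

inductive ideal_glue :: "('w, 'm) triangulation_scheme \<Rightarrow> (nat \<times> nat set) set set \<Rightarrow> nat \<Rightarrow> nat \<Rightarrow>
    nat \<Rightarrow> (nat \<Rightarrow> nat) \<Rightarrow> (nat \<times> nat \<times> nat \<times> nat) list \<Rightarrow> bool"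
  for T H i m where
  ideal_glue_start: "glue T i m = (j, \<pi>) \<Longrightarrow> ideal_glue T H i m j \<pi> []"
| ideal_glue_through:
    "\<lbrakk>ideal_glue T H i m j \<pi> ws; a' < 4; a' \<noteq> \<pi> m; proj_simplex T (j, {\<pi> m, a'}) \<in> H; glue T j a' = (j', \<pi>')\<rbrakk>
     \<Longrightarrow> ideal_glue T H i m j' (\<pi>' \<circ> Transposition.transpose (\<pi> m) a' \<circ> \<pi>) (ws @ [(inv_into UNIV \<pi> a', j, a', \<pi> m)])"

text \<open>Closed curves in \<open>M\<close> without back-tracking: the cyclic list of the tetrahedra of the ideal
  triangulation that are crossed, each with its entering and departing face.\<close>

definition closed_curve :: "('w, 'm) triangulation_scheme \<Rightarrow> (nat \<times> nat set) set set \<Rightarrow> (nat \<times> nat \<times> nat) list \<Rightarrow> bool" where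
  "closed_curve T H s \<longleftrightarrow> s \<noteq> [] \<and>
     (\<forall>(i, a, b)\<in>set s. ideal_tet T H i \<and> a < 4 \<and> b < 4 \<and> a \<noteq> b) \<and>
     (\<forall>n<length s. case s ! n of (i, a, b) \<Rightarrow> case s ! (Suc n mod length s) of (j, a', b') \<Rightarrow>
        \<exists>\<pi> ws. ideal_glue T H i b j \<pi> ws \<and> a' = \<pi> b)"

section \<open>Curves on the boundary tori\<close>

text \<open>
  The triangle \<open>(i, k)\<close> of \<open>\<tau>\<close> truncates the ideal tetrahedron \<open>i\<close> at vertex \<open>k\<close>. Its vertices are
  labelled by the \<open>l \<noteq> k\<close> (and lie on the edges \<open>kl\<close>), and its side \<open>a\<close> lies in the face opposite
  to \<open>a\<close>; points of it have barycentric coordinates indexed by the \<open>l \<noteq> k\<close>.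
\<close>

definition bd_triangles :: "('w, 'm) triangulation_scheme \<Rightarrow> (nat \<times> nat set) set set \<Rightarrow> (nat \<times> nat) set" where
  "bd_triangles T H = {(i, k). ideal_tet T H i \<and> k < 4}"

definition bd_adjacent :: "('w, 'm) triangulation_scheme \<Rightarrow> (nat \<times> nat set) set set \<Rightarrow> ((nat \<times> nat) \<times> (nat \<times> nat)) set" where
  "bd_adjacent T H = {((i, k), (j, \<pi> k)) | i k j \<pi> m ws.
     ideal_tet T H i \<and> ideal_tet T H j \<and> k < 4 \<and> m < 4 \<and> m \<noteq> k \<and> ideal_glue T H i m j \<pi> ws}"

definition bd_components :: "('w, 'm) triangulation_scheme \<Rightarrow> (nat \<times> nat set) set set \<Rightarrow> (nat \<times> nat) set set" where
  "bd_components T H = bd_triangles T H // (bd_adjacent T H)\<^sup>*"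

text \<open>An arc crosses the triangle \<open>(tet, corner)\<close> from the point \<open>pin\<close> of side \<open>side_in\<close> to the point \<open>pout\<close>
  of side \<open>side_out\<close>; \<open>via\<close> and \<open>passed\<close> are the gluing data on leaving it. Arcs are straight: a system of
  arcs in a triangle, each joining two distinct sides, can be straightened without changing
  the endpoints, and without adding intersections if any two arcs meet at most once.\<close>

record bd_arc =
  tet :: nat
  corner :: nat
  side_in :: nat
  side_out :: nat
  pin :: "nat \<Rightarrow> real"
  pout :: "nat \<Rightarrow> real"
  via :: "nat \<Rightarrow> nat"
  passed :: "(nat \<times> nat \<times> nat \<times> nat) list"

definition arc_ok :: "('w, 'm) triangulation_scheme \<Rightarrow> (nat \<times> nat set) set set \<Rightarrow> bd_arc \<Rightarrow> bool" where
  "arc_ok T H u \<longleftrightarrow> ideal_tet T H (tet u) \<and> corner u < 4 \<and> side_in u < 4 \<and> side_out u < 4 \<and>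
     distinct [corner u, side_in u, side_out u] \<and>
     pin u \<in> standard_simplex 3 \<and> {l. pin u l \<noteq> 0} = {..<4} - {corner u, side_in u} \<and>
     pout u \<in> standard_simplex 3 \<and> {l. pout u l \<noteq> 0} = {..<4} - {corner u, side_out u}"

definition bd_curve :: "('w, 'm) triangulation_scheme \<Rightarrow> (nat \<times> nat set) set set \<Rightarrow> bd_arc list \<Rightarrow> bool" where
  "bd_curve T H s \<longleftrightarrow> s \<noteq> [] \<and> (\<forall>u\<in>set s. arc_ok T H u) \<and>
     (\<forall>n<length s. let u = s ! n; v = s ! (Suc n mod length s) in
        ideal_glue T H (tet u) (side_out u) (tet v) (via u) (passed u) \<and>
        corner v = via u (corner u) \<and> side_in v = via u (side_out u) \<and>
        (\<forall>l<4. pin v (via u l) = pout u l))"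

definition arc_points :: "bd_arc \<Rightarrow> (nat \<times> nat \<times> (nat \<Rightarrow> real)) set" where
  "arc_points u = {(tet u, corner u, (\<lambda>l. (1 - t) * pin u l + t * pout u l)) | t. 0 \<le> t \<and> t \<le> 1}"

definition simple_bd_curve :: "('w, 'm) triangulation_scheme \<Rightarrow> (nat \<times> nat set) set set \<Rightarrow> bd_arc list \<Rightarrow> bool" where
  "simple_bd_curve T H s \<longleftrightarrow> bd_curve T H s \<and>
     (\<forall>n<length s. \<forall>n'<length s. n \<noteq> n' \<longrightarrow> arc_points (s ! n) \<inter> arc_points (s ! n') = {})"

text \<open>Exactly one intersection point. It lies in the interior of a triangle (otherwise it would be
  counted on both sides), so that it is a transverse crossing of two straight arcs.\<close>

definition meet_transversely_once :: "bd_arc list \<Rightarrow> bd_arc list \<Rightarrow> bool" where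
  "meet_transversely_once s s' \<longleftrightarrow>
     card {(n, n', q). n < length s \<and> n' < length s' \<and> q \<in> arc_points (s ! n) \<inter> arc_points (s' ! n')} = 1"

text \<open>
  The retraction of \<open>U(L)\<close> to \<open>L\<close> carries a boundary curve to an edge loop of \<open>H\<close>, given by the
  entries of \<open>passed\<close> for the corner followed by the curve. As the components of \<open>H\<close> are circles,
  the loop is contractible if and only if it runs through each edge as often in either direction.
  A meridian is an essential simple closed curve that is contractible in \<open>U(L)\<close>; here
  essentiality follows from the existence of a curve meeting it transversely at one point.
\<close>

definition core_path :: "bd_arc list \<Rightarrow> (nat \<times> nat \<times> nat) list" where
  "core_path s = concat (map (\<lambda>u. map snd (filter (\<lambda>w. fst w = corner u) (passed u))) s)"

definition contractible_in_nbhd :: "('w, 'm) triangulation_scheme \<Rightarrow> bd_arc list \<Rightarrow> bool" where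
  "contractible_in_nbhd T s \<longleftrightarrow> (\<forall>g\<in>oedges T.
     length (filter (\<lambda>w. w \<in> g) (core_path s)) =
     length (filter (\<lambda>(j, k, l). (j, l, k) \<in> g) (core_path s)))"

definition curve_system :: "('w, 'm) triangulation_scheme \<Rightarrow> (nat \<times> nat set) set set \<Rightarrow>
    ((nat \<times> nat) set \<Rightarrow> bd_arc list) \<Rightarrow> ((nat \<times> nat) set \<Rightarrow> bd_arc list) \<Rightarrow> bool" where
  "curve_system T H mer lon \<longleftrightarrow> (\<forall>C\<in>bd_components T H.
     simple_bd_curve T H (mer C) \<and> simple_bd_curve T H (lon C) \<and>
     (\<forall>u\<in>set (mer C) \<union> set (lon C). (tet u, corner u) \<in> C) \<and>
     contractible_in_nbhd T (mer C) \<and> meet_transversely_once (mer C) (lon C))"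

text \<open>The selected vertex of \<open>\<tau>\<close> lies on the edge of the tetrahedron common to the faces \<open>side_in\<close> and \<open>side_out\<close>.
  With the outward normal (pointing towards the corner) first, the curve passes positively around
  the selected vertex \<open>l\<close> if and only if the order \<open>(corner, l, side_in, side_out)\<close> is positive.\<close>

definition bd_weight :: "'w topology \<Rightarrow> ('w \<Rightarrow> 'w chain set) \<Rightarrow> ('w, 'm) triangulation_scheme \<Rightarrow>
    (nat \<times> nat set \<Rightarrow> int) \<Rightarrow> bd_arc list \<Rightarrow> int" where
  "bd_weight W ori T c s = (\<Sum>u\<leftarrow>s.
     let l = (THE l. l < 4 \<and> l \<notin> {corner u, side_in u, side_out u})
     in (if positive_order W ori T (tet u) [corner u, l, side_in u, side_out u] then 1 else -1) *
        c (tet u, {corner u, l}))"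

section \<open>Charges\<close>

definition is_integral_charge :: "'w topology \<Rightarrow> ('w \<Rightarrow> 'w chain set) \<Rightarrow> ('w, 'm) triangulation_scheme \<Rightarrow>
    (nat \<times> nat set) set set \<Rightarrow> ((nat \<times> nat) set \<Rightarrow> bd_arc list) \<Rightarrow> ((nat \<times> nat) set \<Rightarrow> bd_arc list) \<Rightarrow>
    (nat \<times> nat set \<Rightarrow> int) \<Rightarrow> bool" where
  "is_integral_charge W ori T H mer lon c \<longleftrightarrow>
     (\<forall>i<ntet T. \<forall>m<4. (\<Sum>S | S \<subseteq> {..<4} - {m} \<and> card S = 2. c (i, S)) = 1) \<and>
     (\<forall>e\<in>edges T. (\<Sum>e'\<in>e. c e') = (if e \<in> H then 0 else 2)) \<and>
     (\<forall>C\<in>bd_components T H. bd_weight W ori T c (mer C) = 0 \<and> bd_weight W ori T c (lon C) = 0) \<and>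
     (\<forall>s. closed_curve T H s \<longrightarrow> even (\<Sum>(i, a, b)\<leftarrow>s. c (i, {..<4} - {a, b})))"

definition half_pred :: "nat \<Rightarrow> nat" where  \<comment> \<open>the \<open>p\<close> of \<open>N = 2p + 1\<close>\<close>
  "half_pred N = (N - 1) div 2"

definition half :: "nat \<Rightarrow> int \<Rightarrow> int" where  \<comment> \<open>\<open>n/2\<close> in \<open>\<int>/N\<int>\<close>\<close>
  "half N n = (int (half_pred N) + 1) * n"

text \<open>\<open>\<int>/N\<int>\<close> is represented by \<open>{0..<N}\<close>. The curves \<open>m\<^sub>i, l\<^sub>i\<close> are any fixed system of such curves.\<close>

definition is_charge :: "nat \<Rightarrow> 'w topology \<Rightarrow> ('w \<Rightarrow> 'w chain set) \<Rightarrow> ('w, 'm) triangulation_scheme \<Rightarrow>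
    (nat \<times> nat set) set set \<Rightarrow> (nat \<times> nat set \<Rightarrow> int) \<Rightarrow> bool" where
  "is_charge N W ori T H c \<longleftrightarrow> (\<exists>mer lon c'. curve_system T H mer lon \<and>
     is_integral_charge W ori T H mer lon c' \<and>
     (\<forall>e\<in>abstract_simplices T 1. c e = half N (c' e) mod int N))"

section \<open>Decorated distinguished triangulations\<close>

record 'w decorated = "'w triangulation" +
  ham :: "(nat \<times> nat set) set set"
  branch :: branching
  coc :: cocycle
  chg :: "nat \<times> nat set \<Rightarrow> int"

definition is_decorated :: "nat \<Rightarrow> 'w topology \<Rightarrow> ('w \<Rightarrow> 'w chain set) \<Rightarrow> 'w set \<Rightarrow> 'w decorated \<Rightarrow> bool" where
  "is_decorated N W ori L T \<longleftrightarrow> distinguished W L T (ham T) \<and>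
     standard_polyhedron (subtopology W (dual_spine T (ham T))) \<and>
     is_branching T (branch T) \<and> is_full_cocycle T (branch T) (coc T) \<and>
     is_charge N W ori T (ham T) (chg T)"

definition bundle_class :: "'w topology \<Rightarrow> 'w decorated \<Rightarrow> ('w, 'e) flat_bundle set" where
  "bundle_class W T = cocycle_class W T (branch T) (coc T)"

definition is_determination :: "nat \<Rightarrow> 'w decorated \<Rightarrow> (complex \<Rightarrow> complex) \<Rightarrow> bool" where
  "is_determination N T d \<longleftrightarrow> (\<exists>U. open U \<and> connected U \<and> 0 \<notin> U \<and> continuous_on U d \<and>
     (\<forall>w\<in>U. d w ^ N = w) \<and> (\<forall>e\<in>edges T. \<forall>r q. coc T e $ r $ q \<noteq> 0 \<longrightarrow> coc T e $ r $ q \<in> U))"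

section \<open>The state sum\<close>

definition omega :: "nat \<Rightarrow> complex" where
  "omega N = exp (2 * \<i> * of_real pi / of_nat N)"

text \<open>\<open>\<Omega>(x,y,z | n)\<close> and \<open>\<Omega>(x,y,z | m,n)\<close>; the arguments \<open>n\<close>, \<open>m\<close> are integers modulo \<open>N\<close>.\<close>

definition Omega1 :: "nat \<Rightarrow> complex \<times> complex \<times> complex \<Rightarrow> int \<Rightarrow> complex" where
  "Omega1 N = (\<lambda>(x, y, z) n. \<Prod>j = 1..nat (n mod int N). y / (z - x * omega N ^ j))"

definition Omega2 :: "nat \<Rightarrow> complex \<times> complex \<times> complex \<Rightarrow> int \<Rightarrow> int \<Rightarrow> complex" where
  "Omega2 N A m n = Omega1 N A (m - n) * omega N powi half N (n\<^sup>2)"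

text \<open>The principal powers give the branch with value \<open>1\<close> at \<open>0\<close> on the plane cut along the rays
  where some \<open>x \<omega>\<^sup>j\<close> is real and at least \<open>1\<close>.\<close>

definition gN :: "nat \<Rightarrow> complex \<Rightarrow> complex" where
  "gN N x = (\<Prod>j = 1..<N. (1 - x * omega N ^ j) powr (of_nat j / of_nat N))"

definition hN :: "nat \<Rightarrow> complex \<Rightarrow> complex" where
  "hN N x = inverse (x ^ half_pred N) * gN N x / gN N 1"

definition brN :: "nat \<Rightarrow> complex \<Rightarrow> complex" where  \<comment> \<open>the bracket \<open>[x]\<close>\<close>
  "brN N x = inverse (of_nat N) * ((1 - x ^ N) / (1 - x))"

definition deltaN :: "nat \<Rightarrow> int \<Rightarrow> complex" where
  "deltaN N n = (if int N dvd n then 1 else 0)"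

definition states :: "nat \<Rightarrow> 'w decorated \<Rightarrow> ((nat \<times> nat set) set \<Rightarrow> int) set" where
  "states N T = faces T \<rightarrow>\<^sub>E {0..<int N}"

definition tet_weight :: "nat \<Rightarrow> 'w topology \<Rightarrow> ('w \<Rightarrow> 'w chain set) \<Rightarrow> 'w decorated \<Rightarrow>
    (complex \<Rightarrow> complex) \<Rightarrow> ((nat \<times> nat set) set \<Rightarrow> int) \<Rightarrow> nat \<Rightarrow> complex" where
  "tet_weight N W ori T d \<alpha> i =
    (let p = half_pred N;
         \<omega> = omega N;
         v = branch_vertex (branch T) i;
         x = (\<lambda>r q. d (coc T (proj_simplex T (i, {v r, v q})) $ 1 $ 2));
         c = (\<lambda>r q. chg T (i, {v r, v q}));
         a = (\<lambda>k. \<alpha> (proj_simplex T (i, {..<4} - {v k})));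
         A = (x 0 3 * x 1 2, x 0 1 * x 2 3, x 0 2 * x 1 3);
         A' = (x 0 3 * x 1 2 / \<omega>, x 0 1 * x 2 3, x 0 2 * x 1 3);
         \<nu> = hN N ((x 0 2 * x 1 3) / (x 0 3 * x 1 2))
     in if tet_index W ori T (branch T) i = -1
        then (x 0 2 * x 1 3) ^ p * \<omega> powi (c 1 2 * (a 2 - a 3) - half N (c 0 1 * c 1 2)) *
             \<nu> * \<omega> powi (a 3 * a 0) * Omega2 N A (a 2 - c 0 1) (a 3) * deltaN N (a 2 + a 0 - a 1)
        else (x 0 2 * x 1 3) ^ p * \<omega> powi (c 1 2 * (a 2 - a 3) + half N (c 0 1 * c 1 2)) *
             (brN N ((x 0 3 * x 1 2) / (x 0 2 * x 1 3)) / \<nu>) * \<omega> powi (- (a 3 * a 0)) *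
             (deltaN N (a 2 + a 0 - a 1) / Omega2 N A' (a 2 + c 0 1) (a 3)))"

definition state_sum :: "nat \<Rightarrow> 'w topology \<Rightarrow> ('w \<Rightarrow> 'w chain set) \<Rightarrow> 'w decorated \<Rightarrow> (complex \<Rightarrow> complex) \<Rightarrow> complex" where
  "state_sum N W ori T d =
     (inverse (of_nat N ^ card (verts T)) *
      (\<Sum>\<alpha>\<in>states N T. (\<Prod>i<ntet T. tet_weight N W ori T d \<alpha> i) *
         (\<Prod>e\<in>edges T - ham T. inverse (d (coc T e $ 1 $ 2) ^ (2 * half_pred N))))) ^ N"

text \<open>The common value of the state sums; their invariance says that the set below is a singleton.\<close>

definition quantum_invariant :: "nat \<Rightarrow> 'w topology \<Rightarrow> ('w \<Rightarrow> 'w chain set) \<Rightarrow> 'w set \<Rightarrow> ('w, 'e) flat_bundle set \<Rightarrow> complex" where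
  "quantum_invariant N W ori L \<rho> = the_elem {state_sum N W ori T d | T d.
     is_decorated N W ori L T \<and> bundle_class W T = \<rho> \<and> is_determination N T d}"

end

theory Submission
  imports Defs
begin

text \<open>
  If \<open>\<mu>\<^sup>2 = \<lambda>\<close>, then \<open>D = diag(\<mu>, \<mu>\<^sup>-\<^sup>1)\<close> lies in \<open>B\<close> and \<open>z\<^sub>\<lambda>(e) = D z(e) D\<^sup>-\<^sup>1\<close>. So \<open>z\<^sub>\<lambda>\<close> and \<open>z\<close> are
  equivalent through a constant gauge transformation, \<open>\<rho>\<^sub>\<lambda> = \<rho>\<close>, and no property of the state sum
  is needed.
\<close>

lemma borel_group_mult:
  assumes "g \<in> borel_group" "h \<in> borel_group"
  shows "g ** h \<in> borel_group"
proof -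
  have "(g ** h)$2$1 = 0"
    using assms by (simp add: borel_group_def matrix_matrix_mult_def sum_2)
  then show ?thesis
    using assms by (simp add: borel_group_def det_mul)
qed

lemma borel_group_inverse:
  assumes "g \<in> borel_group"
  obtains h where "h \<in> borel_group" "g ** h = mat 1" "h ** g = mat 1"
proof
  \<comment> \<open>The adjugate of \<open>g\<close>, with its lower left entry already set to 0; it
    inverts \<open>g\<close> because \<open>det g = 1\<close>.\<close>
  define h :: "complex^2^2" where "h = vector [vector [g$2$2, - g$1$2], vector [0, g$1$1]]"
  have g: "g$2$1 = 0" "g$1$1 * g$2$2 = 1"
    using assms by (auto simp: borel_group_def det_2)
  show "h \<in> borel_group"
    using g by (simp add: borel_group_def det_2 h_def mult.commute)
  show "g ** h = mat 1" "h ** g = mat 1"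
    using g by (simp_all add: h_def matrix_matrix_mult_def mat_def vec_eq_iff forall_2 sum_2 mult.commute)
qed

lemma flat_bundle_act:
  assumes "is_flat_bundle W E" "u \<in> topspace (total E)" "g \<in> borel_group"
  shows "bact E u g \<in> topspace (total E)" "bproj E (bact E u g) = bproj E u"
    and "h \<in> borel_group \<Longrightarrow> bact E u (g ** h) = bact E (bact E u g) h"
  using assms unfolding is_flat_bundle_def by blast+

text \<open>The definition of a flat bundle does not assert that the action is continuous; the
  trivializations yield it. In the chart given by a section \<open>s\<close>, acting by
  \<open>g\<close> becomes \<open>(x, h) \<mapsto> (x, h ** g)\<close>, which is continuous, and the
  charts cover the total space.\<close>

lemma continuous_map_bact:
  assumes E: "is_flat_bundle W E" and g: "g \<in> borel_group"
  shows "continuous_map (total E) (total E) (\<lambda>u. bact E u g)"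
proof -
  define V where "V U = {u \<in> topspace (total E). bproj E u \<in> U}" for U
  have proj: "continuous_map (total E) W (bproj E)"
    using E by (simp add: is_flat_bundle_def)
  have sec: "openin W U" "\<And>x. x \<in> U \<Longrightarrow> s x \<in> topspace (total E)"
    "homeomorphic_map (prod_topology (subtopology W U) (top_of_set borel_group))
       (subtopology (total E) (V U)) (\<lambda>(x, h). bact E (s x) h)"
    if "(U, s) \<in> flat_sections E" for U s
    using E that unfolding is_flat_bundle_def V_def by blast+
  have openV: "openin (total E) (V U)" if "(U, s) \<in> flat_sections E" for U s
    unfolding V_def using openin_continuous_map_preimage[OF proj] sec(1)[OF that] by blast
  have cont: "continuous_map (subtopology (total E) (V U)) (total E) (\<lambda>u. bact E u g)"
    if us: "(U, s) \<in> flat_sections E" for U s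
  proof -
    let ?P = "prod_topology (subtopology W U) (top_of_set borel_group)"
    let ?\<Phi> = "\<lambda>(x, h). bact E (s x) h"
    \<comment> \<open>The chart is a homeomorphism, hence a quotient map, so continuity of the
      action on \<open>V U\<close> may be tested after composition with the chart.\<close>
    have q: "quotient_map ?P (subtopology (total E) (V U)) ?\<Phi>"
      using sec(3)[OF us] homeomorphic_map_def by blast
    have "continuous_on borel_group (\<lambda>h. h ** g)"
      unfolding matrix_matrix_mult_def by (intro continuous_intros)
    then have "continuous_map (top_of_set borel_group) (top_of_set borel_group) (\<lambda>h. h ** g)"
      using g by (auto simp: borel_group_mult)
    then have "continuous_map ?P ?P (\<lambda>(x, h). (x, h ** g))"
      by (intro continuous_map_prod_top[THEN iffD2]) auto
    moreover have "continuous_map ?P (total E) ?\<Phi>"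
      using sec(3)[OF us] continuous_map_in_subtopology homeomorphic_imp_continuous_map by blast
    ultimately have "continuous_map ?P (total E) (?\<Phi> \<circ> (\<lambda>(x, h). (x, h ** g)))"
      by (rule continuous_map_compose)
    \<comment> \<open>Associativity of the action moves \<open>g\<close> from inside the chart to
      outside: \<open>s x\<close> acted on by \<open>h ** g\<close> is \<open>s x\<close> acted on
      by \<open>h\<close> and then by \<open>g\<close>.\<close>
    then have "continuous_map ?P (total E) ((\<lambda>u. bact E u g) \<circ> ?\<Phi>)"
    proof (rule continuous_map_eq)
      fix p assume "p \<in> topspace ?P"
      then show "(?\<Phi> \<circ> (\<lambda>(x, h). (x, h ** g))) p = ((\<lambda>u. bact E u g) \<circ> ?\<Phi>) p"
        using flat_bundle_act(3)[OF E] sec(2)[OF us] g by auto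
    qed
    then show ?thesis
      by (rule continuous_compose_quotient_map[OF q])
  qed
  show ?thesis
  \<comment> \<open>The local maps are all the same map, so they agree on overlaps trivially; what
    is left is that the sets \<open>V U\<close> cover the total space.\<close>
  proof (rule pasting_lemma[where I = "flat_sections E" and T = "\<lambda>(U, s). V U" and f = "\<lambda>_ u. bact E u g"])
    fix u assume u: "u \<in> topspace (total E)"
    then have "bproj E u \<in> topspace W"
      using proj continuous_map_image_subset_topspace by fastforce
    moreover have "\<forall>x\<in>topspace W. \<exists>(U, s)\<in>flat_sections E. x \<in> U"
      using E by (simp add: is_flat_bundle_def)
    ultimately obtain U s where "(U, s) \<in> flat_sections E" "bproj E u \<in> U"
      by fast
    then show "\<exists>j. j \<in> flat_sections E \<and> u \<in> (case j of (U, s) \<Rightarrow> V U) \<and> bact E u g = bact E u g"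
      using u by (intro exI[of _ "(U, s)"]) (simp add: V_def)
  qed (use openV cont in auto)
qed

text \<open>Where the path is a flat section \<open>s\<close> translated by a constant
  \<open>h\<close>, its translate by \<open>g\<close> is the same section translated by the constant
  \<open>h ** g\<close>, over the same points of the base.\<close>

lemma horizontal_path_bact:
  assumes E: "is_flat_bundle W E" and g: "g \<in> borel_group" and \<gamma>: "horizontal_path E \<gamma>"
  shows "horizontal_path E (\<lambda>t. bact E (\<gamma> t) g)"
proof -
  have c: "continuous_map (top_of_set {0..1}) (total E) \<gamma>"
    using \<gamma> by (simp add: horizontal_path_def)
  then have top: "\<gamma> t \<in> topspace (total E)" if "t \<in> {0..1}" for t
    using that continuous_map_image_subset_topspace by fastforce
  have "continuous_map (top_of_set {0..1}) (total E) (\<lambda>t. bact E (\<gamma> t) g)"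
    using continuous_map_compose[OF c continuous_map_bact[OF E g]] by (simp add: o_def)
  moreover have "\<exists>(U, s)\<in>flat_sections E. \<exists>h\<in>borel_group. \<exists>r>0. \<forall>t'\<in>{0..1}. \<bar>t' - t\<bar> < r \<longrightarrow>
      bproj E (bact E (\<gamma> t') g) \<in> U \<and> bact E (\<gamma> t') g = bact E (s (bproj E (bact E (\<gamma> t') g))) h"
    if t: "t \<in> {0..1}" for t
  proof -
    obtain U s h r where us: "(U, s) \<in> flat_sections E" and h: "h \<in> borel_group" and r: "r > 0"
      and loc: "\<And>t'. t' \<in> {0..1} \<Longrightarrow> \<bar>t' - t\<bar> < r \<Longrightarrow> bproj E (\<gamma> t') \<in> U \<and> \<gamma> t' = bact E (s (bproj E (\<gamma> t'))) h"
      using \<gamma> t unfolding horizontal_path_def by fast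
    have s: "s x \<in> topspace (total E)" if "x \<in> U" for x
      using E us that unfolding is_flat_bundle_def by blast
    have "bproj E (bact E (\<gamma> t') g) \<in> U \<and>
        bact E (\<gamma> t') g = bact E (s (bproj E (bact E (\<gamma> t') g))) (h ** g)"
      if "t' \<in> {0..1}" "\<bar>t' - t\<bar> < r" for t'
      using loc[OF that] flat_bundle_act(2)[OF E top[OF that(1)] g] flat_bundle_act(3)[OF E s h g]
      by metis
    then show ?thesis
      using us borel_group_mult[OF h g] r by blast
  qed
  ultimately show ?thesis
    by (simp add: horizontal_path_def)
qed

lemma proj_simplex_edge:
  assumes "i < ntet T" "k < 4" "l < 4" "k \<noteq> l"
  shows "proj_simplex T (i, {k, l}) \<in> edges T"
  unfolding simplices_def proj_simplex_def
  by (rule quotientI) (use assms in \<open>auto simp: abstract_simplices_def\<close>)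

text \<open>The hypothesis \<open>gauge\<close> is the equivalence of cocycles, with
  \<open>g\<close> as the function on vertices, cleared of inverses. The same bundle realizes both
  cocycles; only the chosen points over the vertices move.\<close>

lemma cocycle_class_gauge_subset:
  assumes g: "\<And>v. g v \<in> borel_group"
    and z: "\<And>e. e \<in> edges T \<Longrightarrow> z e \<in> borel_group" and z': "\<And>e. e \<in> edges T \<Longrightarrow> z' e \<in> borel_group"
    and gauge: "\<And>i k l. \<lbrakk>i < ntet T; k < 4; l < 4; k \<noteq> l; b i k l\<rbrakk> \<Longrightarrow>
      g (proj_simplex T (i, {k})) ** z' (proj_simplex T (i, {k, l})) =
      z (proj_simplex T (i, {k, l})) ** g (proj_simplex T (i, {l}))"
  shows "cocycle_class W T b z \<subseteq> cocycle_class W T b z'"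
proof
  fix E assume "E \<in> cocycle_class W T b z"
  then obtain \<sigma> where E: "is_flat_bundle W E"
    and \<sigma>: "\<forall>i<ntet T. \<forall>k<4. \<sigma> (proj_simplex T (i, {k})) \<in> topspace (total E) \<and>
        bproj E (\<sigma> (proj_simplex T (i, {k}))) = chmap T i (bvertex k)"
    and path: "\<forall>i<ntet T. \<forall>k<4. \<forall>l<4. k \<noteq> l \<and> b i k l \<longrightarrow>
        (\<exists>\<gamma>. horizontal_path E \<gamma> \<and> (\<forall>t\<in>{0..1}. bproj E (\<gamma> t) = edge_path T i k l t) \<and>
           \<gamma> 0 = bact E (\<sigma> (proj_simplex T (i, {k}))) (z (proj_simplex T (i, {k, l}))) \<and>
           \<gamma> 1 = \<sigma> (proj_simplex T (i, {l})))"
    unfolding cocycle_class_def mem_Collect_eq by (elim conjE exE) (rule that)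
  \<comment> \<open>Changing base points by \<open>g\<close> is what replaces \<open>z\<close> by
    \<open>z'\<close>.\<close>
  define \<sigma>' where "\<sigma>' v = bact E (\<sigma> v) (g v)" for v
  have "\<exists>\<gamma>. horizontal_path E \<gamma> \<and> (\<forall>t\<in>{0..1}. bproj E (\<gamma> t) = edge_path T i k l t) \<and>
      \<gamma> 0 = bact E (\<sigma>' (proj_simplex T (i, {k}))) (z' (proj_simplex T (i, {k, l}))) \<and>
      \<gamma> 1 = \<sigma>' (proj_simplex T (i, {l}))"
    if ikl: "i < ntet T" "k < 4" "l < 4" "k \<noteq> l" "b i k l" for i k l
  proof -
    let ?v = "proj_simplex T (i, {k})" and ?w = "proj_simplex T (i, {l})"
      and ?e = "proj_simplex T (i, {k, l})"
    obtain \<gamma> where \<gamma>: "horizontal_path E \<gamma>" "\<forall>t\<in>{0..1}. bproj E (\<gamma> t) = edge_path T i k l t"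
      "\<gamma> 0 = bact E (\<sigma> ?v) (z ?e)" "\<gamma> 1 = \<sigma> ?w"
      using path ikl by meson
    have e: "?e \<in> edges T"
      using ikl proj_simplex_edge by blast
    \<comment> \<open>The laws of the action hold only on the total space, so the lift has to be
      known to stay there.\<close>
    have "\<gamma> t \<in> topspace (total E)" if "t \<in> {0..1}" for t
      using \<gamma>(1) that continuous_map_image_subset_topspace unfolding horizontal_path_def by fastforce
    then have "\<forall>t\<in>{0..1}. bproj E (bact E (\<gamma> t) (g ?w)) = edge_path T i k l t"
      using \<gamma>(2) flat_bundle_act(2)[OF E _ g] by simp
    \<comment> \<open>The new lift is the old one translated by the value of \<open>g\<close> at the
      terminal vertex. Its end is then the new base point by construction, and \<open>gauge\<close>
      puts its start in the required form.\<close>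
    moreover have "bact E (\<gamma> 0) (g ?w) = bact E (\<sigma>' ?v) (z' ?e)"
    proof -
      have v: "\<sigma> ?v \<in> topspace (total E)"
        using \<sigma> ikl by blast
      have "bact E (\<gamma> 0) (g ?w) = bact E (\<sigma> ?v) (z ?e ** g ?w)"
        using flat_bundle_act(3)[OF E v z[OF e] g] \<gamma>(3) by simp
      also have "\<dots> = bact E (\<sigma> ?v) (g ?v ** z' ?e)"
        using gauge[OF ikl] by simp
      also have "\<dots> = bact E (\<sigma>' ?v) (z' ?e)"
        using flat_bundle_act(3)[OF E v g z'[OF e]] by (simp add: \<sigma>'_def)
      finally show ?thesis .
    qed
    ultimately show ?thesis
      using horizontal_path_bact[OF E g \<gamma>(1)] \<gamma>(4)
      by (intro exI[of _ "\<lambda>t. bact E (\<gamma> t) (g ?w)"]) (simp add: \<sigma>'_def)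
  qed
  moreover have "\<sigma>' (proj_simplex T (i, {k})) \<in> topspace (total E) \<and>
      bproj E (\<sigma>' (proj_simplex T (i, {k}))) = chmap T i (bvertex k)"
    if "i < ntet T" "k < 4" for i k
    using \<sigma> that flat_bundle_act(1,2)[OF E _ g] by (simp add: \<sigma>'_def)
  ultimately show "E \<in> cocycle_class W T b z'"
    using E unfolding cocycle_class_def by (intro CollectI conjI exI[of _ \<sigma>']) simp_all
qed

text \<open>Equivalence of cocycles is symmetric: the pointwise inverse \<open>h\<close> of
  \<open>g\<close> carries \<open>z'\<close> back to \<open>z\<close>, which gives the reverse
  inclusion.\<close>

lemma cocycle_class_gauge:
  assumes g: "\<And>v. g v \<in> borel_group"
    and z: "\<And>e. e \<in> edges T \<Longrightarrow> z e \<in> borel_group" and z': "\<And>e. e \<in> edges T \<Longrightarrow> z' e \<in> borel_group"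
    and gauge: "\<And>i k l. \<lbrakk>i < ntet T; k < 4; l < 4; k \<noteq> l; b i k l\<rbrakk> \<Longrightarrow>
      g (proj_simplex T (i, {k})) ** z' (proj_simplex T (i, {k, l})) =
      z (proj_simplex T (i, {k, l})) ** g (proj_simplex T (i, {l}))"
  shows "cocycle_class W T b z = cocycle_class W T b z'"
proof
  show "cocycle_class W T b z \<subseteq> cocycle_class W T b z'"
    using assms by (rule cocycle_class_gauge_subset)
  have "\<exists>h. h \<in> borel_group \<and> g v ** h = mat 1 \<and> h ** g v = mat 1" for v
    using borel_group_inverse[OF g] by metis
  then obtain h where h: "\<And>v. h v \<in> borel_group" "\<And>v. g v ** h v = mat 1" "\<And>v. h v ** g v = mat 1"
    by metis
  show "cocycle_class W T b z' \<subseteq> cocycle_class W T b z"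
  proof (rule cocycle_class_gauge_subset[of h, OF h(1) z' z])
    fix i k l assume "i < ntet T" "k < 4" "l < 4" "k \<noteq> l" "b i k l"
    note eq = gauge[OF this]
    let ?v = "proj_simplex T (i, {k})" and ?w = "proj_simplex T (i, {l})"
      and ?e = "proj_simplex T (i, {k, l})"
    \<comment> \<open>The relation \<open>eq\<close> is multiplied by \<open>h ?v\<close> on the
      left and by \<open>h ?w\<close> on the right.\<close>
    have "h ?v ** z ?e = h ?v ** (z ?e ** g ?w) ** h ?w"
      by (metis h(2) matrix_mul_assoc matrix_mul_rid)
    also have "\<dots> = z' ?e ** h ?w"
      by (metis eq h(3) matrix_mul_assoc matrix_mul_lid)
    finally show "h ?v ** z ?e = z' ?e ** h ?w" .
  qed
qed

text \<open>Conjugation by \<open>D\<close> fixes the diagonal of an upper triangular matrix and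
  multiplies its upper right entry by the square of \<open>\<mu>\<close>, which is
  \<open>lam\<close>.\<close>

lemma cocycle_class_scale:
  assumes z: "\<And>e. e \<in> edges T \<Longrightarrow> z e \<in> borel_group" and lam: "lam \<noteq> 0"
  shows "cocycle_class W T b (scale_cocycle lam z) = cocycle_class W T b z"
proof -
  define \<mu> where "\<mu> = csqrt lam"
  have \<mu>: "\<mu> \<noteq> 0" "\<mu> * \<mu> = lam"
    using lam by (simp_all add: \<mu>_def flip: power2_eq_square)
  define D :: "complex^2^2" where "D = vector [vector [\<mu>, 0], vector [0, inverse \<mu>]]"
  \<comment> \<open>\<open>scale_cocycle\<close> writes the lower row as 0 and the inverse of the
    first diagonal entry, whatever \<open>z e\<close> is. Membership in \<open>B\<close> makes this
    agree with the lower row of \<open>z e\<close>.\<close>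
  have diag: "z e $ 2 $ 1 = 0" "z e $ 1 $ 1 \<noteq> 0" "z e $ 2 $ 2 = inverse (z e $ 1 $ 1)" if "e \<in> edges T" for e
    using z[OF that] by (auto simp: borel_group_def det_2 inverse_unique)
  have D: "D \<in> borel_group"
    using \<mu> by (simp add: D_def borel_group_def det_2)
  have sz: "scale_cocycle lam z e \<in> borel_group" if "e \<in> edges T" for e
    using diag[OF that] by (simp add: scale_cocycle_def borel_group_def det_2)
  \<comment> \<open>This is the gauge relation for the constant function \<open>D\<close>, with the
    scaled cocycle in the role of \<open>z\<close> and the original one in the role of
    \<open>z'\<close>.\<close>
  have conj: "D ** z e = scale_cocycle lam z e ** D" if "e \<in> edges T" for e
    using diag[OF that] \<mu>(1)
    by (simp add: D_def scale_cocycle_def matrix_matrix_mult_def vec_eq_iff forall_2 sum_2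
        flip: \<mu>(2))
  show ?thesis
    by (rule cocycle_class_gauge[of "\<lambda>_. D"]) (blast intro: D sz z conj proj_simplex_edge)+
qed

theorem proposition4p4:
  fixes N :: nat
    and W :: "'w topology"
    and ori :: "'w \<Rightarrow> 'w chain set"
    and L :: "'w set"
    and \<rho> :: "('w, 'e) flat_bundle set"
    and T :: "'w decorated"
  assumes "odd N"
    and "closed_3manifold W" and "connected_space W" and "is_orientation W ori"
    and "is_link W L"
    and "\<rho> \<in> flat_bundle_classes W"
    and "is_decorated N W ori L T"
    and "bundle_class W T = \<rho>"
  shows "\<forall>lam::complex. lam \<noteq> 0 \<longrightarrow>
    quantum_invariant N W ori L
      (cocycle_class W T (branch T) (scale_cocycle lam (coc T)) :: ('w, 'e) flat_bundle set) =
    quantum_invariant N W ori L \<rho>"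
proof (intro allI impI)
  fix lam :: complex assume "lam \<noteq> 0"
  have "coc T e \<in> borel_group" if "e \<in> edges T" for e
    using assms(7) that by (simp add: is_decorated_def is_full_cocycle_def is_cocycle_def)
  \<comment> \<open>Both arguments of \<open>quantum_invariant\<close> are now the same set of
    bundles, so the two sides of the goal coincide.\<close>
  then have "cocycle_class W T (branch T) (scale_cocycle lam (coc T)) = \<rho>"
    using cocycle_class_scale[OF _ \<open>lam \<noteq> 0\<close>] assms(8) by (metis bundle_class_def)
  then show "quantum_invariant N W ori L (cocycle_class W T (branch T) (scale_cocycle lam (coc T)) :: ('w, 'e) flat_bundle set) =
      quantum_invariant N W ori L \<rho>"
    by simp
qed

end
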